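(* Let $n\geq1$ and let $R\subsetneq\{1,\dots,n\}$ with $|R|=r\geq1$. Then for every ranking $\rho$ on the subsets of $\{1,\dots,n\}$, $$J_n^{(r)}(q)=\sum_{F\in\mathcal{F}_{n,R}}q^{l_\rho(F)}.$$
   Context: Let $\Lambda$ be the ring of symmetric functions in infinitely many variables with coefficients in $\mathbb{Q}(q)$; $e_n$ are the elementary symmetric functions and $m_\lambda$ the monomial symmetric functions. For $n\geq r\geq1$, $p_n^{(r)}=\sum m_\lambda$ over all partitions $\lambda$ of $n$ with exactly $r$ parts. Let $\varphi:\Lambda\to\mathbb{Q}(q)$ be the $\mathbb{Q}(q)$-algebra homomorphism with $\varphi(e_n)=q^{\binom n2}/n!$ for $n\geq1$, and define $J_n^{(r)}(q)$ by $\varphi(p_n^{(r)})=(1-q)^{n-r}\frac{q^{\binom r2}}{r!\,(n-r)!}J_n^{(r)}(q)$. $\mathcal{F}_{n,R}$ is the set of rooted forests with vertex set $\{1,\dots,n\}$ whose set of roots is exactly $R$ (each tree contains exactly one element of $R$ as its root). For $F\in\mathcal{F}_{n,R}$, each non-root vertex $v$ has a unique parent $p(v)$; $V_i$ is the set of vertices at distance $i$ from the root of their tree ($V_0=R$), $u_i=|V_i|$, $k$ is the largest $i$ with $V_i\neq\emptyset$, and $n(u')=\sum_{i=1}^k\binom{u_i}{2}$. A ranking $\rho$ on the subsets of $\{1,\dots,n\}$ assigns to each subset $P$ a bijection $\rho(P):P\to\{1,\dots,|P|\}$. The weight of a vertex $v\in V_i$ is $w_\rho(v)=\rho(V_i)(v)$.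 The level statistic is $l_\rho(F)=n(u')+\sum_{v\in\{1,\dots,n\}\setminus R}\big(w_\rho(p(v))-1\big)$. *)

theory Defs
  imports
    Complex_Main
    "HOL-Library.Multiset"
    "HOL-Computational_Algebra.Computational_Algebra"
begin

section \<open>The ring of symmetric functions\<close>

text \<open>
  The finite multiset \<open>M\<close> of indices stands for the monomial \<open>\<Prod>i\<in>#M. x\<^sub>i\<close> in the variables
  \<open>x\<^sub>0, x\<^sub>1, \<dots>\<close>.  A formal series of such monomials is its coefficient function; it is a
  symmetric function if its degree is bounded and every permutation of the variables fixes it.
\<close>

typedef (overloaded) 'a symfun =
  "{f :: nat multiset \<Rightarrow> 'a::comm_ring_1.
      (\<exists>d. \<forall>M. size M > d \<longrightarrow> f M = 0) \<and>
      (\<forall>\<pi> M. bij \<pi> \<longrightarrow> f (image_mset \<pi> M) = f M)}"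
  morphisms sym_coeff Abs_symfun
  by (rule exI[of _ "\<lambda>_. 0"]) simp

setup_lifting type_definition_symfun

lemma symfun_eqI: "(\<And>M. sym_coeff f M = sym_coeff g M) \<Longrightarrow> f = g"
  by transfer auto

definition splits :: "'b multiset \<Rightarrow> ('b multiset \<times> 'b multiset) set" where
  "splits M = {(A, B). A + B = M}"

lemma finite_splits: "finite (splits M)"
proof -
  have "{A. A \<subseteq># M} \<subseteq> (\<Union>k\<le>size M. multisets_of_size (set_mset M) k)"
    by (auto simp: multisets_of_size_def size_mset_mono dest: mset_subset_eqD)
  moreover have "finite (\<Union>k\<le>size M. multisets_of_size (set_mset M) k)"
    by (auto intro: finite_multisets_of_size)
  ultimately have "finite {A. A \<subseteq># M}" by (rule finite_subset)
  moreover have "splits M \<subseteq> (\<lambda>A. (A, M - A)) ` {A. A \<subseteq># M}"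
    by (auto simp: splits_def)
  ultimately show ?thesis by (meson finite_imageI finite_subset)
qed

lemma splits_image:
  assumes "bij \<pi>"
  shows "(\<Sum>(A, B)\<in>splits (image_mset \<pi> M). F A B)
       = (\<Sum>(A, B)\<in>splits M. F (image_mset \<pi> A) (image_mset \<pi> B))"
proof (rule sum.reindex_bij_witness[of _
      "\<lambda>(A, B). (image_mset \<pi> A, image_mset \<pi> B)"
      "\<lambda>(A, B). (image_mset (inv \<pi>) A, image_mset (inv \<pi>) B)"])
  have 1: "\<pi> \<circ> inv \<pi> = id" and 2: "inv \<pi> \<circ> \<pi> = id"
    using assms by (auto simp: bij_def surj_iff inj_iff)
  have im1: "image_mset \<pi> (image_mset (inv \<pi>) A) = A" for A
    by (simp add: 1 image_mset.compositionality)
  have im2: "image_mset (inv \<pi>) (image_mset \<pi> A) = A" for A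
    by (simp add: 2 image_mset.compositionality)
  show "(\<lambda>(A, B). (image_mset \<pi> A, image_mset \<pi> B))
          ((\<lambda>(A, B). (image_mset (inv \<pi>) A, image_mset (inv \<pi>) B)) a) = a" for a
    by (simp add: im1 split: prod.splits) 
  show "(\<lambda>(A, B). (image_mset (inv \<pi>) A, image_mset (inv \<pi>) B))
          ((\<lambda>(A, B). (image_mset \<pi> A, image_mset \<pi> B)) a) = a" for a
    by (simp add: im2 split: prod.splits)
  show "(\<lambda>(A, B). (image_mset (inv \<pi>) A, image_mset (inv \<pi>) B)) a \<in> splits M"
    if mem: "a \<in> splits (image_mset \<pi> M)" for a
  proof -
    obtain A B where a: "a = (A, B)" "A + B = image_mset \<pi> M"
      using mem by (auto simp: splits_def)
    have "image_mset (inv \<pi>) A + image_mset (inv \<pi>) B = image_mset (inv \<pi>) (A + B)" by simp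
    also have "\<dots> = M" by (simp only: a im2)
    finally show ?thesis by (simp add: a splits_def)
  qed
  show "(\<lambda>(A, B). (image_mset \<pi> A, image_mset \<pi> B)) b \<in> splits (image_mset \<pi> M)"
    if "b \<in> splits M" for b
    using that by (auto simp: splits_def)
  show "(case (\<lambda>(A, B). (image_mset (inv \<pi>) A, image_mset (inv \<pi>) B)) a of
           (A, B) \<Rightarrow> F (image_mset \<pi> A) (image_mset \<pi> B)) = (case a of (A, B) \<Rightarrow> F A B)" for a
    by (simp add: im1 split: prod.splits)
qed

lemma sum_splits_assoc:
  fixes f g h :: "'b multiset \<Rightarrow> 'a::comm_ring_1"
  shows "(\<Sum>(P, C)\<in>splits M. (\<Sum>(A, B)\<in>splits P. f A * g B) * h C)
       = (\<Sum>(A, Q)\<in>splits M. f A * (\<Sum>(B, C)\<in>splits Q. g B * h C))"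
proof -
  have "(\<Sum>(P, C)\<in>splits M. (\<Sum>(A, B)\<in>splits P. f A * g B) * h C)
      = (\<Sum>x\<in>splits M. \<Sum>y\<in>splits (fst x). f (fst y) * g (snd y) * h (snd x))"
    by (simp add: sum_distrib_right case_prod_unfold)
  also have "\<dots> = (\<Sum>(x, y)\<in>Sigma (splits M) (\<lambda>x. splits (fst x)).
      f (fst y) * g (snd y) * h (snd x))"
    by (rule sum.Sigma) (auto simp: finite_splits)
  also have "\<dots> = (\<Sum>(x, y)\<in>Sigma (splits M) (\<lambda>x. splits (snd x)).
      f (fst x) * (g (fst y) * h (snd y)))"
    by (rule sum.reindex_bij_witness[of _
          "\<lambda>((A, Q), (B, C)). ((A + B, C), (A, B))" "\<lambda>((P, C), (A, B)). ((A, B + C), (B, C))"])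
       (auto simp: splits_def ac_simps)
  also have "\<dots> = (\<Sum>x\<in>splits M. \<Sum>y\<in>splits (snd x). f (fst x) * (g (fst y) * h (snd y)))"
    by (rule sum.Sigma[symmetric]) (auto simp: finite_splits)
  also have "\<dots> = (\<Sum>(A, Q)\<in>splits M. f A * (\<Sum>(B, C)\<in>splits Q. g B * h C))"
    by (simp add: sum_distrib_left case_prod_unfold)
  finally show ?thesis .
qed

lemma splits_empty_left:
  fixes f :: "'b multiset \<Rightarrow> 'a::comm_ring_1"
  shows "(\<Sum>(A, B)\<in>splits M. of_bool (A = {#}) * f B) = f M"
proof -
  have "(\<Sum>(A, B)\<in>splits M. of_bool (A = {#}) * f B)
      = (\<Sum>(A, B)\<in>{({#} :: 'b multiset, M)}. of_bool (A = {#}) * f B)"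
    by (rule sum.mono_neutral_right[OF finite_splits]) (auto simp: finite_splits splits_def of_bool_def split: if_splits)
  then show ?thesis by simp
qed

instantiation symfun :: (comm_ring_1) comm_ring_1
begin

lift_definition zero_symfun :: "'a symfun" is "\<lambda>_. 0" by auto

lift_definition one_symfun :: "'a symfun" is "\<lambda>M. of_bool (M = {#})"
  by (auto intro!: exI[of _ 0])

lift_definition plus_symfun :: "'a symfun \<Rightarrow> 'a symfun \<Rightarrow> 'a symfun" is "\<lambda>f g M. f M + g M"
proof -
  fix f g :: "nat multiset \<Rightarrow> 'a"
  assume f: "(\<exists>d. \<forall>M. size M > d \<longrightarrow> f M = 0) \<and> (\<forall>\<pi> M. bij \<pi> \<longrightarrow> f (image_mset \<pi> M) = f M)"
    and g: "(\<exists>d. \<forall>M. size M > d \<longrightarrow> g M = 0) \<and> (\<forall>\<pi> M. bij \<pi> \<longrightarrow> g (image_mset \<pi> M) = g M)"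
  obtain d d' where "\<forall>M. size M > d \<longrightarrow> f M = 0" "\<forall>M. size M > d' \<longrightarrow> g M = 0"
    using f g by blast
  then have "\<forall>M. size M > max d d' \<longrightarrow> f M + g M = 0" by simp
  then have "\<exists>d. \<forall>M. size M > d \<longrightarrow> f M + g M = 0" by (rule exI)
  moreover have "\<forall>\<pi> M. bij \<pi> \<longrightarrow> f (image_mset \<pi> M) + g (image_mset \<pi> M) = f M + g M"
    using f g by simp
  ultimately show "(\<exists>d. \<forall>M. size M > d \<longrightarrow> f M + g M = 0) \<and>
     (\<forall>\<pi> M. bij \<pi> \<longrightarrow> f (image_mset \<pi> M) + g (image_mset \<pi> M) = f M + g M)"
    by (rule conjI)
qed

lift_definition uminus_symfun :: "'a symfun \<Rightarrow> 'a symfun" is "\<lambda>f M. - f M" by auto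

definition minus_symfun :: "'a symfun \<Rightarrow> 'a symfun \<Rightarrow> 'a symfun" where
  "minus_symfun f g = f + - g"

lift_definition times_symfun :: "'a symfun \<Rightarrow> 'a symfun \<Rightarrow> 'a symfun"
  is "\<lambda>f g M. \<Sum>(A, B)\<in>splits M. f A * g B"
proof -
  fix f g :: "nat multiset \<Rightarrow> 'a"
  assume f: "(\<exists>d. \<forall>M. size M > d \<longrightarrow> f M = 0) \<and> (\<forall>\<pi> M. bij \<pi> \<longrightarrow> f (image_mset \<pi> M) = f M)"
    and g: "(\<exists>d. \<forall>M. size M > d \<longrightarrow> g M = 0) \<and> (\<forall>\<pi> M. bij \<pi> \<longrightarrow> g (image_mset \<pi> M) = g M)"
  obtain d d' where d: "\<And>M. size M > d \<Longrightarrow> f M = 0" "\<And>M. size M > d' \<Longrightarrow> g M = 0"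
    using f g by blast
  have "(\<Sum>(A, B)\<in>splits M. f A * g B) = 0" if M: "size M > d + d'" for M
  proof (rule sum.neutral, clarify)
    fix A B assume "(A, B) \<in> splits M"
    then have "size A + size B > d + d'" using M by (auto simp: splits_def)
    then have "size A > d \<or> size B > d'" by linarith
    then show "f A * g B = 0" using d by auto
  qed
  then have "\<exists>d. \<forall>M. size M > d \<longrightarrow> (\<Sum>(A, B)\<in>splits M. f A * g B) = 0" by blast
  moreover have "(\<Sum>(A, B)\<in>splits (image_mset \<pi> M). f A * g B) = (\<Sum>(A, B)\<in>splits M. f A * g B)"
    if "bij \<pi>" for \<pi> M
    using f g that by (simp add: splits_image)
  ultimately show "(\<exists>d. \<forall>M. size M > d \<longrightarrow> (\<Sum>(A, B)\<in>splits M. f A * g B) = 0) \<and>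
     (\<forall>\<pi> M. bij \<pi> \<longrightarrow>
       (\<Sum>(A, B)\<in>splits (image_mset \<pi> M). f A * g B) = (\<Sum>(A, B)\<in>splits M. f A * g B))"
    by blast
qed

instance
proof
  fix a b c :: "'a symfun"
  show "a + b + c = a + (b + c)" by transfer (simp add: add.assoc)
  show "a + b = b + a" by transfer (simp add: add.commute)
  show "0 + a = a" by transfer simp
  show "- a + a = 0" by transfer simp
  show "a - b = a + - b" by (simp add: minus_symfun_def)
  show "a * b * c = a * (b * c)" by transfer (simp add: sum_splits_assoc)
  show "a * b = b * a"
  proof (rule symfun_eqI)
    fix M
    show "sym_coeff (a * b) M = sym_coeff (b * a) M"
      unfolding times_symfun.rep_eq
      by (rule sum.reindex_bij_witness[of _ prod.swap prod.swap])
         (auto simp: splits_def ac_simps)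
  qed
  show "1 * a = a" by transfer (simp add: splits_empty_left)
  show "(a + b) * c = a * c + b * c"
    by transfer (simp add: distrib_right sum.distrib case_prod_unfold)
  show "(0 :: 'a symfun) \<noteq> 1"
    by transfer (simp add: fun_eq_iff exI[of _ "{#}"])
qed

end

lift_definition sym_scale :: "'a::comm_ring_1 \<Rightarrow> 'a symfun \<Rightarrow> 'a symfun" is "\<lambda>c f M. c * f M"
  by fastforce

definition algebra_hom :: "('a::comm_ring_1 symfun \<Rightarrow> 'a) \<Rightarrow> bool" where
  "algebra_hom \<phi> \<longleftrightarrow>
     (\<forall>f g. \<phi> (f + g) = \<phi> f + \<phi> g) \<and>
     (\<forall>f g. \<phi> (f * g) = \<phi> f * \<phi> g) \<and>
     \<phi> 1 = 1 \<and>
     (\<forall>c f. \<phi> (sym_scale c f) = c * \<phi> f)"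

text \<open>The square-free monomials of degree \<open>n\<close>, each with coefficient 1.\<close>

lift_definition elem_sym :: "nat \<Rightarrow> 'a::comm_ring_1 symfun" is
  "\<lambda>n M. of_bool (\<exists>A. finite A \<and> card A = n \<and> M = mset_set A)"
proof (intro conjI allI impI)
  fix n :: nat
  show "\<exists>d. \<forall>M. d < size M \<longrightarrow>
      (of_bool (\<exists>A. finite A \<and> card A = n \<and> M = mset_set A) :: 'a) = 0"
    by (rule exI[of _ n]) auto
next
  fix n :: nat and \<pi> :: "nat \<Rightarrow> nat" and M
  assume \<pi>: "bij \<pi>"
  have *: "\<exists>A. finite A \<and> card A = n \<and> image_mset \<sigma> N = mset_set A"
    if \<sigma>: "bij \<sigma>" and N: "\<exists>A. finite A \<and> card A = n \<and> N = mset_set A" for \<sigma> :: "nat \<Rightarrow> nat" and N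
  proof -
    obtain A where A: "finite A" "card A = n" "N = mset_set A" using N by blast
    have "inj_on \<sigma> A" using inj_on_subset[OF bij_is_inj[OF \<sigma>]] by simp
    then show ?thesis
      using A by (intro exI[of _ "\<sigma> ` A"]) (simp add: card_image image_mset_mset_set)
  qed
  have "image_mset (inv \<pi>) (image_mset \<pi> M) = M"
    using \<pi> by (simp add: image_mset.compositionality bij_is_inj)
  then have "(\<exists>A. finite A \<and> card A = n \<and> image_mset \<pi> M = mset_set A)
      \<longleftrightarrow> (\<exists>A. finite A \<and> card A = n \<and> M = mset_set A)"
    using *[OF bij_imp_bij_inv[OF \<pi>], of "image_mset \<pi> M"] *[OF \<pi>, of M] by auto
  then show "(of_bool (\<exists>A. finite A \<and> card A = n \<and> image_mset \<pi> M = mset_set A) :: 'a)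
      = of_bool (\<exists>A. finite A \<and> card A = n \<and> M = mset_set A)"
    by simp
qed

text \<open>The multiset of the nonzero exponents of a monomial.\<close>

definition exponents :: "nat multiset \<Rightarrow> nat multiset" where
  "exponents M = image_mset (count M) (mset_set (set_mset M))"

lemma sum_exponents: "sum_mset (exponents M) = size M"
  by (simp add: exponents_def size_multiset_overloaded_eq sum_unfold_sum_mset)

lemma exponents_image:
  assumes "bij \<pi>"
  shows "exponents (image_mset \<pi> M) = exponents M"
proof -
  have inj: "inj \<pi>" using assms by (rule bij_is_inj)
  have "exponents (image_mset \<pi> M)
      = image_mset (count (image_mset \<pi> M)) (image_mset \<pi> (mset_set (set_mset M)))"
    by (simp add: exponents_def image_mset_mset_set inj_on_subset[OF inj])
  also have "\<dots> = image_mset (\<lambda>x. count (image_mset \<pi> M) (\<pi> x)) (mset_set (set_mset M))"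
    by (simp add: image_mset.compositionality comp_def)
  also have "\<dots> = exponents M"
  proof -
    have "count (image_mset \<pi> M) (\<pi> x) = count M x" for x
      by (induction M) (auto simp: inj_eq[OF inj])
    then show ?thesis by (simp add: exponents_def)
  qed
  finally show ?thesis .
qed

text \<open>
  A partition is the multiset of its (positive) parts; the monomial symmetric function of \<open>\<mu>\<close> is
  the sum of all monomials whose exponents, in some order, are the parts of \<open>\<mu>\<close>.
\<close>

lift_definition mono_sym :: "nat multiset \<Rightarrow> 'a::comm_ring_1 symfun" is
  "\<lambda>\<mu> M. of_bool (exponents M = \<mu>)"
proof (intro conjI allI impI)
  fix \<mu> :: "nat multiset"
  show "\<exists>d. \<forall>M. d < size M \<longrightarrow> (of_bool (exponents M = \<mu>) :: 'a) = 0"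
    by (rule exI[of _ "sum_mset \<mu>"]) (auto simp: sum_exponents)
qed (simp add: exponents_image)

definition partitions_parts :: "nat \<Rightarrow> nat \<Rightarrow> nat multiset set" where
  "partitions_parts n r = {\<mu>. 0 \<notin># \<mu> \<and> sum_mset \<mu> = n \<and> size \<mu> = r}"

lemma finite_partitions_parts: "finite (partitions_parts n r)"
proof (rule finite_subset)
  show "partitions_parts n r \<subseteq> multisets_of_size {..n} r"
    by (auto simp: partitions_parts_def multisets_of_size_def dest!: multi_member_split)
  show "finite (multisets_of_size {..n} r)" by (rule finite_multisets_of_size) simp
qed

definition p_sym :: "nat \<Rightarrow> nat \<Rightarrow> 'a::comm_ring_1 symfun" where
  "p_sym n r = (\<Sum>\<mu>\<in>partitions_parts n r. mono_sym \<mu>)"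


section \<open>The rational functions \<open>J\<close>\<close>

type_synonym ratfun = "rat poly fract"

definition q :: ratfun where
  "q = Fract [:0, 1:] 1"

definition J_fun :: "(ratfun symfun \<Rightarrow> ratfun) \<Rightarrow> nat \<Rightarrow> nat \<Rightarrow> ratfun" where
  "J_fun \<phi> n r =
     \<phi> (p_sym n r) / ((1 - q) ^ (n - r) * (q ^ (r choose 2) / (fact r * fact (n - r))))"

lemma J_fun_iff:
  "\<phi> (p_sym n r) = (1 - q) ^ (n - r) * (q ^ (r choose 2) / (fact r * fact (n - r))) * j
     \<longleftrightarrow> j = J_fun \<phi> n r"
proof -
  have "q \<noteq> 0" "1 - q \<noteq> 0"
    by (auto simp: q_def Zero_fract_def One_fract_def eq_fract one_pCons)
  then show ?thesis by (auto simp: J_fun_def field_simps)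
qed


section \<open>Rooted forests\<close>

text \<open>
  A graph on \<open>V\<close> is its set of edges, which are two-element subsets of \<open>V\<close>.  Since the set \<open>R\<close> of
  roots is prescribed, a forest rooted at \<open>R\<close> is determined by its underlying graph.
\<close>

definition adj :: "'v set set \<Rightarrow> 'v rel" where
  "adj E = {(u, v). u \<noteq> v \<and> {u, v} \<in> E}"

definition is_cycle :: "'v set set \<Rightarrow> 'v list \<Rightarrow> bool" where
  "is_cycle E vs \<longleftrightarrow> length vs \<ge> 3 \<and> distinct vs \<and>
     (\<forall>i<length vs. (vs ! i, vs ! (Suc i mod length vs)) \<in> adj E)"

definition rooted_forests :: "'v set \<Rightarrow> 'v set \<Rightarrow> 'v set set set" where
  "rooted_forests V R = {E.
     E \<subseteq> {e. e \<subseteq> V \<and> card e = 2} \<and>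
     (\<nexists>vs. is_cycle E vs) \<and>
     (\<forall>T\<in>V // (adj E)\<^sup>*. \<exists>!r. r \<in> T \<inter> R)}"

definition root_of :: "'v set set \<Rightarrow> 'v set \<Rightarrow> 'v \<Rightarrow> 'v" where
  "root_of E R v = (THE r. r \<in> R \<and> (v, r) \<in> (adj E)\<^sup>*)"

definition gdist :: "'v set set \<Rightarrow> 'v \<Rightarrow> 'v \<Rightarrow> nat" where
  "gdist E u v = (LEAST k. (u, v) \<in> adj E ^^ k)"

definition depth :: "'v set set \<Rightarrow> 'v set \<Rightarrow> 'v \<Rightarrow> nat" where
  "depth E R v = gdist E (root_of E R v) v"

text \<open>The neighbour of \<open>v\<close> on the path from \<open>v\<close> to the root.\<close>

definition parent :: "'v set set \<Rightarrow> 'v set \<Rightarrow> 'v \<Rightarrow> 'v" where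
  "parent E R v = (THE u. (u, v) \<in> adj E \<and> depth E R v = Suc (depth E R u))"

definition level :: "'v set \<Rightarrow> 'v set set \<Rightarrow> 'v set \<Rightarrow> nat \<Rightarrow> 'v set" where
  "level V E R i = {v \<in> V. depth E R v = i}"

definition height :: "'v set \<Rightarrow> 'v set set \<Rightarrow> 'v set \<Rightarrow> nat" where
  "height V E R = Max {i. level V E R i \<noteq> {}}"


section \<open>Rankings and the level statistic\<close>

definition is_ranking :: "'v set \<Rightarrow> ('v set \<Rightarrow> 'v \<Rightarrow> nat) \<Rightarrow> bool" where
  "is_ranking V \<rho> \<longleftrightarrow> (\<forall>P\<subseteq>V. bij_betw (\<rho> P) P {1..card P})"

definition weight ::
  "'v set \<Rightarrow> ('v set \<Rightarrow> 'v \<Rightarrow> nat) \<Rightarrow> 'v set set \<Rightarrow> 'v set \<Rightarrow> 'v \<Rightarrow> nat" where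
  "weight V \<rho> E R v = \<rho> (level V E R (depth E R v)) v"

text \<open>The truncated subtraction is harmless, since weights are at least 1.\<close>

definition level_stat ::
  "'v set \<Rightarrow> ('v set \<Rightarrow> 'v \<Rightarrow> nat) \<Rightarrow> 'v set \<Rightarrow> 'v set set \<Rightarrow> nat" where
  "level_stat V \<rho> R E =
     (\<Sum>i=1..height V E R. card (level V E R i) choose 2) +
     (\<Sum>v\<in>V - R. weight V \<rho> E R (parent E R v) - 1)"

end

theory Submission
  imports Defs
begin

text \<open>
  Let \<open>E(t)\<close> be the image under \<open>\<phi>\<close> of the generating function of the \<open>e\<^sub>n\<close>.  The identity
  \<open>(\<Sum>n r. p\<^sub>n\<^sup>(\<^sup>r\<^sup>) y\<^sup>r t\<^sup>n) * (\<Sum>n. e\<^sub>n (- t)\<^sup>n) = \<Sum>n. e\<^sub>n ((y - 1) t)\<^sup>n\<close> shows that, up to elementary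
  factors, \<open>(1 - q)\<^sup>m J\<close> with \<open>m = n - r\<close> is the coefficient of \<open>t\<^sup>m / m!\<close> in
  \<open>H\<^sub>r = E(- q\<^sup>r t) / E(- t)\<close>.  Splitting off the roots of a forest, and then the \<open>j\<close> vertices of depth 1
  as roots of a smaller forest, gives a recursion for the generating function of the level
  statistic.  Each vertex of depth 1 chooses its parent with total weight \<open>1 + q + \<dots> + q\<^sup>r\<^sup>-\<^sup>1\<close>,
  whatever the ranking.  By the binomial theorem
  \<open>E(- q\<^sup>r t) = \<Sum>j. q ^ (j choose 2) * (1 - q\<^sup>r)\<^sup>j * t\<^sup>j / j! * E(- q\<^sup>j t)\<close>, and division by
  \<open>E(- t)\<close> yields the same recursion for the coefficients of \<open>H\<^sub>r\<close>.
\<close>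

section \<open>The series \<open>E(- q\<^sup>r t) / E(- t)\<close>\<close>

lemma choose_two_add: "(a + b) choose 2 = (a choose 2) + (b choose 2) + a * b" for a b :: nat
  by (induction b) (auto simp: numeral_2_eq_2)

text \<open>
  With \<open>E(t) = \<Sum>m. x ^ (m choose 2) * t ^ m / fact m\<close>, the series \<open>qexp x r\<close> is \<open>E(- x ^ r * t)\<close>.
\<close>

definition qexp :: "'a::field_char_0 \<Rightarrow> nat \<Rightarrow> 'a fps" where
  "qexp x r = Abs_fps (\<lambda>m. (- (x ^ r)) ^ m * x ^ (m choose 2) / fact m)"

definition qratio :: "'a::field_char_0 \<Rightarrow> nat \<Rightarrow> 'a fps" where
  "qratio x r = qexp x r * inverse (qexp x 0)"

lemma qexp_nth: "qexp x r $ m = (- 1) ^ m * x ^ (r * m) * x ^ (m choose 2) / fact m"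
  by (simp add: qexp_def power_minus[of "x ^ r"] power_mult)

lemma qexp_nth_0: "qexp x r $ 0 = 1"
  by (simp add: qexp_def numeral_2_eq_2)

lemma qexp_mult_qratio: "qexp x 0 * qratio x r = qexp x r"
proof -
  have "qexp x 0 * inverse (qexp x 0) = 1"
    by (rule inverse_mult_eq_1') (simp add: qexp_nth_0)
  then show ?thesis
    by (simp add: qratio_def mult.left_commute)
qed

text \<open>Write -x^r = (1 - x^r) - 1 and expand its m-th power by the binomial theorem. In m
  choose 2 = (j choose 2) + ((m - j) choose 2) + j(m - j), the cross term is what turns E(-t) into
  E(-x^j t).\<close>

lemma qexp_nth_expand:
  fixes x :: "'a::field_char_0"
  shows
  "qexp x r $ m = (\<Sum>j\<le>m. x ^ (j choose 2) * (1 - x ^ r) ^ j / fact j * qexp x j $ (m - j))"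
proof -
  have "x ^ (j choose 2) * (1 - x ^ r) ^ j / fact j * qexp x j $ (m - j)
      = x ^ (m choose 2) / fact m * (of_nat (m choose j) * (1 - x ^ r) ^ j * (- 1) ^ (m - j))"
    if "j \<le> m" for j
  proof -
    have m: "m choose 2 = (j choose 2) + ((m - j) choose 2) + j * (m - j)"
      using choose_two_add[of j "m - j"] that by simp
    have bin: "of_nat (m choose j) = (fact m / (fact j * fact (m - j)) :: 'a)"
      using that by (rule binomial_fact)
    show ?thesis
      unfolding m bin qexp_nth by (simp add: power_add)
  qed
  then have "(\<Sum>j\<le>m. x ^ (j choose 2) * (1 - x ^ r) ^ j / fact j * qexp x j $ (m - j))
      = (\<Sum>j\<le>m. x ^ (m choose 2) / fact m *
          (of_nat (m choose j) * (1 - x ^ r) ^ j * (- 1) ^ (m - j)))"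
    by simp
  also have "\<dots> = x ^ (m choose 2) / fact m * ((1 - x ^ r) + - 1) ^ m"
    by (simp only: binomial_ring sum_distrib_left)
  also have "\<dots> = qexp x r $ m"
    by (simp add: qexp_def)
  finally show ?thesis ..
qed

text \<open>The preceding expansion is an infinite sum of shifted series; dividing by E(-t) one
  coefficient at a time needs only rearrangements of finite sums.\<close>

lemma qratio_nth_expand:
  "qratio x r $ m = (\<Sum>j\<le>m. x ^ (j choose 2) * (1 - x ^ r) ^ j / fact j * qratio x j $ (m - j))"
proof -
  define c where "c j = x ^ (j choose 2) * (1 - x ^ r) ^ j / fact j" for j
  define I where "I = inverse (qexp x 0)"
  have "qratio x r $ m = (\<Sum>k\<le>m. \<Sum>j\<le>k. c j * qexp x j $ (k - j) * I $ (m - k))"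
    unfolding qratio_def fps_mult_nth I_def[symmetric] c_def
    by (simp only: qexp_nth_expand[of x r] sum_distrib_right atLeast0AtMost)
  also have "\<dots> = (\<Sum>(k, j)\<in>Sigma {..m} atMost. c j * qexp x j $ (k - j) * I $ (m - k))"
    by (rule sum.Sigma) auto
  also have "\<dots> = (\<Sum>(j, i)\<in>Sigma {..m} (\<lambda>j. {..m - j}).
      c j * qexp x j $ i * I $ (m - j - i))"
    by (rule sum.reindex_bij_witness[of _ "\<lambda>(j, i). (j + i, j)" "\<lambda>(k, j). (j, k - j)"]) auto
  also have "\<dots> = (\<Sum>j\<le>m. \<Sum>i\<le>m - j. c j * qexp x j $ i * I $ (m - j - i))"
    by (rule sum.Sigma[symmetric]) auto
  also have "\<dots> = (\<Sum>j\<le>m. c j * qratio x j $ (m - j))"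
    unfolding qratio_def fps_mult_nth I_def[symmetric]
    by (simp add: sum_distrib_left atLeast0AtMost mult.assoc)
  finally show ?thesis
    unfolding c_def .
qed

definition qcount :: "'a::field_char_0 \<Rightarrow> nat \<Rightarrow> nat \<Rightarrow> 'a" where
  "qcount x r m = fact m * qratio x r $ m"

text \<open>The factor m! turns 1/j! into (m choose j) (m - j)!, so that j can count the vertices of
  depth 1 chosen among m non-roots.\<close>

lemma qcount_rec:
  "qcount x r m =
     (\<Sum>j\<le>m. of_nat (m choose j) * (x ^ (j choose 2) * (1 - x ^ r) ^ j * qcount x j (m - j)))"
  unfolding qcount_def
  by (subst qratio_nth_expand) (auto simp: sum_distrib_left binomial_fact intro!: sum.cong)

text \<open>At r = 0 the recursion says nothing, since (1 - x^0)^j kills every term but j = 0. This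
  base case replaces it: a forest without roots has no vertices.\<close>

lemma qcount_0: "qcount x 0 m = of_bool (m = 0)"
proof -
  have "qratio x 0 = 1"
    unfolding qratio_def by (rule inverse_mult_eq_1') (simp add: qexp_nth_0)
  then show ?thesis by (simp add: qcount_def)
qed

lemma sum_card_subsets:
  fixes f :: "nat \<Rightarrow> 'a::semiring_1"
  assumes "finite A"
  shows "(\<Sum>S\<in>Pow A. f (card S)) = (\<Sum>j\<le>card A. of_nat (card A choose j) * f j)"
proof -
  have "(\<Sum>S\<in>Pow A. f (card S)) = (\<Sum>j\<le>card A. \<Sum>S\<in>{S\<in>Pow A. card S = j}. f (card S))"
    using assms by (intro sum.group[symmetric]) (auto intro: card_mono)
  also have "\<dots> = (\<Sum>j\<le>card A. of_nat (card A choose j) * f j)"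
  proof (rule sum.cong[OF refl])
    fix j
    have "(\<Sum>S\<in>{S\<in>Pow A. card S = j}. f (card S)) = (\<Sum>S\<in>{S\<in>Pow A. card S = j}. f j)"
      by (rule sum.cong) auto
    then show "(\<Sum>S\<in>{S\<in>Pow A. card S = j}. f (card S)) = of_nat (card A choose j) * f j"
      using n_subsets[OF assms, of j] by simp
  qed
  finally show ?thesis .
qed


section \<open>Symmetric functions\<close>

lemma sym_coeff_sum: "sym_coeff (\<Sum>i\<in>I. f i) M = (\<Sum>i\<in>I. sym_coeff (f i) M)"
  by (induction I rule: infinite_finite_induct) (auto simp: zero_symfun.rep_eq plus_symfun.rep_eq)

lemma elem_sym_0: "elem_sym 0 = 1"
  by (rule symfun_eqI) (auto simp: elem_sym.rep_eq one_symfun.rep_eq intro!: exI[of _ "{}"])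

text \<open>A monomial occurs in exactly one m_lambda, namely for lambda =
  \<open>exponents M\<close>; the sum of this lambda is the degree and its number of parts is the
  size of the support.\<close>

lemma sym_coeff_p_sym:
  "sym_coeff (p_sym n r) M = of_bool (size M = n \<and> card (set_mset M) = r)"
proof -
  have "sym_coeff (p_sym n r) M
      = (\<Sum>\<mu>\<in>partitions_parts n r. of_bool (exponents M = \<mu>))"
    by (simp add: p_sym_def sym_coeff_sum mono_sym.rep_eq)
  also have "\<dots> = of_bool (exponents M \<in> partitions_parts n r)"
    by (simp only: of_bool_def sum.delta'[OF finite_partitions_parts])
  also have "exponents M \<in> partitions_parts n r \<longleftrightarrow> size M = n \<and> card (set_mset M) = r"
  proof -
    have "0 \<notin> count M ` set_mset M" by (metis imageE not_in_iff)
    then have "0 \<notin># exponents M" "size (exponents M) = card (set_mset M)"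
      by (simp_all add: exponents_def)
    then show ?thesis by (simp add: partitions_parts_def sum_exponents)
  qed
  finally show ?thesis .
qed

lemma mset_set_subset_mset: "X \<subseteq> set_mset M \<Longrightarrow> mset_set X \<subseteq># M"
  by (rule mset_subset_eqI) (auto simp: count_mset_set' Suc_le_eq)

text \<open>A square-free factor of \<open>M\<close> is determined by its support, which can be any
  subset of the support of \<open>M\<close>.\<close>

lemma sym_coeff_elem_sym_mult:
  fixes f :: "'a::comm_ring_1 symfun"
  shows "sym_coeff (elem_sym k * f) M
     = (\<Sum>X | X \<subseteq> set_mset M \<and> card X = k. sym_coeff f (M - mset_set X))"
proof -
  let ?e = "\<lambda>A. \<exists>X. finite X \<and> card X = k \<and> A = mset_set X"
  have restrict: "(\<Sum>(A, B)\<in>splits M. of_bool (P A) * g B)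
      = (\<Sum>(A, B)\<in>{(A, B)\<in>splits M. P A}. g B)" for P and g :: "nat multiset \<Rightarrow> 'a"
    by (rule sum.mono_neutral_cong_right) (auto simp: finite_splits of_bool_def split: if_splits)
  have "sym_coeff (elem_sym k * f) M
      = (\<Sum>(A, B)\<in>splits M. of_bool (?e A) * sym_coeff f B)"
    by (simp add: times_symfun.rep_eq elem_sym.rep_eq)
  also have "\<dots> = (\<Sum>(A, B)\<in>{(A, B)\<in>splits M. ?e A}. sym_coeff f B)"
    by (rule restrict)
  also have "\<dots> = (\<Sum>X | X \<subseteq> set_mset M \<and> card X = k. sym_coeff f (M - mset_set X))"
  proof (rule sum.reindex_bij_witness[of _
        "\<lambda>X. (mset_set X, M - mset_set X)" "\<lambda>(A, B). set_mset A"])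
    fix P assume "P \<in> {(A, B) \<in> splits M. ?e A}"
    then obtain X B where X: "P = (mset_set X, B)" "finite X" "card X = k" "mset_set X + B = M"
      by (auto simp: splits_def)
    then show "(\<lambda>X. (mset_set X, M - mset_set X)) ((\<lambda>(A, B). set_mset A) P) = P"
      and "(\<lambda>(A, B). set_mset A) P \<in> {X. X \<subseteq> set_mset M \<and> card X = k}"
      and "sym_coeff f (M - mset_set ((\<lambda>(A, B). set_mset A) P)) = (\<lambda>(A, B). sym_coeff f B) P"
      by auto
  next
    fix X assume "X \<in> {X. X \<subseteq> set_mset M \<and> card X = k}"
    then have X: "X \<subseteq> set_mset M" "finite X" "card X = k"
      using finite_subset by blast+
    then show "(\<lambda>(A, B). set_mset A) (mset_set X, M - mset_set X) = X" by simp
    have "mset_set X + (M - mset_set X) = M"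
      using mset_set_subset_mset[OF X(1)] by simp
    then show "(mset_set X, M - mset_set X) \<in> {(A, B) \<in> splits M. ?e A}"
      using X(2,3) unfolding splits_def by blast
  qed
  finally show ?thesis .
qed

lemma sum_Pow_toggle:
  fixes h :: "'b set \<Rightarrow> 'a::ab_group_add"
  assumes "finite S" "x \<in> S" and "\<And>X. X \<subseteq> S - {x} \<Longrightarrow> h (insert x X) = - h X"
  shows "(\<Sum>X\<in>Pow S. h X) = 0"
proof -
  have "Pow S = Pow (S - {x}) \<union> insert x ` Pow (S - {x})"
    using assms(2) by (metis Pow_insert insert_Diff)
  moreover have "inj_on (insert x) (Pow (S - {x}))"
    by (auto simp: inj_on_def)
  moreover have "Pow (S - {x}) \<inter> insert x ` Pow (S - {x}) = {}" by auto
  ultimately have "(\<Sum>X\<in>Pow S. h X)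
      = (\<Sum>X\<in>Pow (S - {x}). h X) + (\<Sum>X\<in>Pow (S - {x}). h (insert x X))"
    using assms(1) by (simp add: sum.union_disjoint sum.reindex)
  also have "(\<Sum>X\<in>Pow (S - {x}). h (insert x X)) = (\<Sum>X\<in>Pow (S - {x}). - h X)"
    using assms(3) by (intro sum.cong) auto
  finally show ?thesis by (simp add: sum_negf)
qed

text \<open>
  If some \<open>x\<close> has multiplicity at least 2 in \<open>M\<close>, toggling the membership of \<open>x\<close> in \<open>X\<close> does not
  change the support of \<open>M - mset_set X\<close>, so the signs cancel.
\<close>

lemma sum_sign_support:
  fixes M :: "'b multiset"
  assumes size: "size M = m + r"
  shows "(\<Sum>X\<in>Pow (set_mset M).
      (- 1) ^ card X * of_bool (card (set_mset (M - mset_set X)) = r))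
    = ((- 1) ^ m * of_nat ((m + r) choose r) :: 'a::comm_ring_1)
       * of_bool (\<exists>A. finite A \<and> card A = m + r \<and> M = mset_set A)"
proof (cases "\<exists>x\<in>#M. count M x \<ge> 2")
  case True
  then obtain x where x: "x \<in># M" "count M x \<ge> 2" by blast
  have "\<not> (\<exists>A. finite A \<and> card A = m + r \<and> M = mset_set A)"
    using x by (auto simp: count_mset_set')
  moreover have "(\<Sum>X\<in>Pow (set_mset M).
      (- 1) ^ card X * of_bool (card (set_mset (M - mset_set X)) = r)) = (0 :: 'a)"
  proof (rule sum_Pow_toggle)
    fix X assume X: "X \<subseteq> set_mset M - {x}"
    then have fin: "finite X" using finite_subset by blast
    have "set_mset (M - mset_set (insert x X)) = set_mset (M - mset_set X)"
      using x X fin by (auto simp: set_mset_diff count_mset_set')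
    then show "(- 1) ^ card (insert x X) * of_bool (card (set_mset (M - mset_set (insert x X))) = r)
        = - ((- 1 :: 'a) ^ card X * of_bool (card (set_mset (M - mset_set X)) = r))"
      using X fin by (auto simp: card_insert_if)
  qed (use x in auto)
  ultimately show ?thesis by (simp only: of_bool_def if_False mult_zero_right)
next
  case False
  define S where "S = set_mset M"
  have "count M x = count (mset_set S) x" for x
  proof (cases "x \<in># M")
    case True
    then have "\<not> count M x \<ge> 2" "count M x > 0" using False by auto
    then have "count M x = 1" by linarith
    then show ?thesis using True by (simp add: S_def)
  qed (simp add: S_def not_in_iff)
  then have M: "M = mset_set S" by (rule multiset_eqI)
  have S: "finite S" "card S = m + r"
    using size by (simp_all add: S_def) (metis M S_def size_mset_set)
  \<comment> \<open>\<open>M\<close> is square-free here, so removing \<open>X\<close> leaves the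
    support \<open>S - X\<close>. Only the sets with m elements survive, all with the same
    sign.\<close>
  have "(\<Sum>X\<in>Pow S. (- 1) ^ card X * of_bool (card (set_mset (M - mset_set X)) = r))
      = (\<Sum>X\<in>Pow S. (- 1 :: 'a) ^ card X * of_bool (card X = m))"
  proof (rule sum.cong[OF refl])
    fix X assume "X \<in> Pow S"
    then have X: "X \<subseteq> S" "finite X" using S finite_subset by auto
    have "set_mset (M - mset_set X) = S - X"
      using X S by (subst M) (simp add: mset_set_Diff[symmetric])
    moreover have "card X \<le> m + r" using X S card_mono by metis
    ultimately have "card (set_mset (M - mset_set X)) = r \<longleftrightarrow> card X = m"
      using X S by (auto simp: card_Diff_subset)
    then show "(- 1) ^ card X * of_bool (card (set_mset (M - mset_set X)) = r)
        = (- 1 :: 'a) ^ card X * of_bool (card X = m)" by simp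
  qed
  also have "\<dots> = (\<Sum>j\<le>m + r. of_nat ((m + r) choose j) * ((- 1) ^ j * of_bool (j = m)))"
    using sum_card_subsets[OF S(1), of "\<lambda>j. (- 1) ^ j * of_bool (j = m)"] S by simp
  also have "\<dots> = (\<Sum>j\<in>{m}. of_nat ((m + r) choose j) * ((- 1) ^ j * of_bool (j = m)))"
    by (rule sum.mono_neutral_right) auto
  also have "\<dots> = (- 1) ^ m * of_nat ((m + r) choose r)"
    using binomial_symmetric[of m "m + r"] by simp
  finally have "(\<Sum>X\<in>Pow S. (- 1) ^ card X * of_bool (card (set_mset (M - mset_set X)) = r))
      = ((- 1) ^ m * of_nat ((m + r) choose r) :: 'a)" .
  moreover have "\<exists>A. finite A \<and> card A = m + r \<and> M = mset_set A"
    using M S by blast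
  ultimately show ?thesis
    unfolding S_def by (simp only: of_bool_def if_True mult_1_right)
qed

text \<open>
  The coefficient of \<open>y ^ r * t ^ (m + r)\<close> in \<open>E(-t) * P(y, t) = E((y - 1) * t)\<close>, where \<open>E\<close> and \<open>P\<close> are
  the generating functions of \<open>elem_sym\<close> and \<open>p_sym\<close>: indeed \<open>P\<close> is the product over the variables
  of \<open>1 + y * x\<^sub>i * t / (1 - x\<^sub>i * t) = (1 + (y - 1) * x\<^sub>i * t) / (1 - x\<^sub>i * t)\<close>.
\<close>

lemma elem_sym_p_sym_identity:
  "(\<Sum>k\<le>m. sym_scale ((- 1) ^ k) (elem_sym k * p_sym (m - k + r) r))
     = sym_scale ((- 1) ^ m * of_nat ((m + r) choose r)) (elem_sym (m + r) :: 'a::comm_ring_1 symfun)"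
proof (rule symfun_eqI)
  fix M :: "nat multiset"
  let ?S = "set_mset M"
  let ?h = "\<lambda>X. (- 1 :: 'a) ^ card X *
    of_bool (size M = m + r \<and> card (set_mset (M - mset_set X)) = r)"
  have size: "size (M - mset_set X) = size M - card X" "card X \<le> size M" if "X \<subseteq> ?S" for X
  proof -
    have "mset_set X \<subseteq># M"
      using that by (rule mset_set_subset_mset)
    then show "size (M - mset_set X) = size M - card X" "card X \<le> size M"
      using size_mset_mono[of "mset_set X" M] by (simp_all add: size_Diff_submset)
  qed
  have "sym_coeff (\<Sum>k\<le>m. sym_scale ((- 1) ^ k) (elem_sym k * p_sym (m - k + r) r)) M
      = (\<Sum>k\<le>m. \<Sum>X | X \<subseteq> ?S \<and> card X = k. (- 1 :: 'a) ^ k *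
           of_bool (size (M - mset_set X) = m - k + r \<and> card (set_mset (M - mset_set X)) = r))"
    by (simp only: sym_coeff_sum sym_scale.rep_eq sym_coeff_elem_sym_mult sym_coeff_p_sym
        sum_distrib_left)
  \<comment> \<open>For k \<le> m the degree condition is independent of k, so the double sum is a
    single sum grouped by the size of \<open>X\<close>.\<close>
  also have "\<dots> = (\<Sum>k\<le>m. \<Sum>X\<in>{X\<in>{X\<in>Pow ?S. card X \<le> m}. card X = k}. ?h X)"
  proof (rule sum.cong[OF refl], rule sum.cong)
    fix k X
    assume "k \<in> {..m}" "X \<in> {X\<in>{X\<in>Pow ?S. card X \<le> m}. card X = k}"
    then have k: "k \<le> m" "card X = k" "X \<subseteq> ?S" by auto
    then have "size (M - mset_set X) = m - k + r \<longleftrightarrow> size M = m + r"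
      using size[of X] by auto
    then show "(- 1 :: 'a) ^ k *
        of_bool (size (M - mset_set X) = m - k + r \<and> card (set_mset (M - mset_set X)) = r) = ?h X"
      using k by simp
  qed auto
  also have "\<dots> = (\<Sum>X\<in>{X\<in>Pow ?S. card X \<le> m}. ?h X)"
    by (rule sum.group) auto
  \<comment> \<open>If \<open>X\<close> has more than m elements, fewer than r of the m + r elements
    of \<open>M\<close> remain, too few for a support of size r.\<close>
  also have "\<dots> = (\<Sum>X\<in>Pow ?S. ?h X)"
  proof (rule sum.mono_neutral_left)
    show "\<forall>X\<in>Pow ?S - {X\<in>Pow ?S. card X \<le> m}. ?h X = 0"
    proof
      fix X assume X: "X \<in> Pow ?S - {X\<in>Pow ?S. card X \<le> m}"
      have "card (set_mset N) \<le> size N" for N :: "nat multiset"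
        using size_mset_mono[OF mset_set_set_mset_msubset[of N]] by simp
      from this[of "M - mset_set X"] show "?h X = 0" using size[of X] X by auto
    qed
  qed auto
  also have "\<dots> = sym_coeff (sym_scale ((- 1) ^ m * of_nat ((m + r) choose r)) (elem_sym (m + r))) M"
  proof (cases "size M = m + r")
    case True
    then show ?thesis
      unfolding sym_scale.rep_eq elem_sym.rep_eq
      by (simp only: simp_thms sum_sign_support[OF True])
  next
    case False
    then have "\<not> (\<exists>A. finite A \<and> card A = m + r \<and> M = mset_set A)" by auto
    with False show ?thesis
      unfolding sym_scale.rep_eq elem_sym.rep_eq
      by (simp only: of_bool_def if_False mult_zero_right simp_thms sum.neutral_const)
  qed
  finally show "sym_coeff (\<Sum>k\<le>m. sym_scale ((- 1) ^ k) (elem_sym k * p_sym (m - k + r) r)) M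
    = sym_coeff (sym_scale ((- 1) ^ m * of_nat ((m + r) choose r)) (elem_sym (m + r) :: 'a symfun)) M" .
qed

text \<open>Keeping only the coefficient of y^r gives an identity in t whose coefficients are finite
  sums, so \<phi> can be applied. Cancelling \<open>qexp x 0\<close>, the image of E(-t), leaves a
  constant times \<open>qratio x r\<close>.\<close>

lemma algebra_hom_p_sym:
  fixes \<phi> :: "'a::field_char_0 symfun \<Rightarrow> 'a"
  assumes hom: "algebra_hom \<phi>"
    and e: "\<And>m. m \<ge> 1 \<Longrightarrow> \<phi> (elem_sym m) = x ^ (m choose 2) / fact m"
  shows "\<phi> (p_sym (m + r) r) = x ^ (r choose 2) / (fact r * fact m) * qcount x r m"
proof -
  have add: "\<phi> (f + g) = \<phi> f + \<phi> g" and mult: "\<phi> (f * g) = \<phi> f * \<phi> g" and one: "\<phi> 1 = 1"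
    and scale: "\<phi> (sym_scale c f) = c * \<phi> f" for f g c
    using hom by (auto simp: algebra_hom_def)
  have zero: "\<phi> 0 = 0" using add[of 0 0] by simp
  have sum: "\<phi> (\<Sum>i\<in>I. f i) = (\<Sum>i\<in>I. \<phi> (f i))" for I :: "nat set" and f
    by (induction I rule: infinite_finite_induct) (auto simp: add zero)
  \<comment> \<open>The formula extends to m = 0 because e_0 = 1 and 0 choose 2 = 0.\<close>
  have e': "\<phi> (elem_sym m) = x ^ (m choose 2) / fact m" for m
    using e[of m] by (cases "m = 0") (auto simp: elem_sym_0 one numeral_2_eq_2)
  define A where "A = Abs_fps (\<lambda>m. \<phi> (p_sym (m + r) r))"
  define c where "c = x ^ (r choose 2) / fact r"
  have "qexp x 0 * A = fps_const c * qexp x r"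
  proof (rule fps_ext)
    fix m
    have "(qexp x 0 * A) $ m
        = \<phi> (\<Sum>k\<le>m. sym_scale ((- 1) ^ k) (elem_sym k * p_sym (m - k + r) r))"
      by (simp add: fps_mult_nth A_def qexp_def sum scale mult e' atLeast0AtMost mult.assoc)
    also have "\<dots> = (- 1) ^ m * of_nat ((m + r) choose r) * (x ^ ((m + r) choose 2) / fact (m + r))"
      by (simp only: elem_sym_p_sym_identity scale e')
    \<comment> \<open>The binomial coefficient trades (m + r)! for r! m!, and the cross term r m of
      (m + r) choose 2 becomes the twist x^(r m) in E(-x^r t).\<close>
    also have "\<dots> = c * qexp x r $ m"
    proof -
      have "of_nat ((m + r) choose r) = (fact (m + r) / (fact r * fact m) :: 'a)"
        using binomial_fact[of r "m + r"] by simp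
      then show ?thesis
        by (simp add: c_def qexp_nth choose_two_add power_add mult.commute[of m r])
    qed
    finally show "(qexp x 0 * A) $ m = (fps_const c * qexp x r) $ m" by simp
  qed
  also have "\<dots> = qexp x 0 * (fps_const c * qratio x r)"
    by (simp add: mult.left_commute[of "qexp x 0"] qexp_mult_qratio)
  finally have "qexp x 0 * A = qexp x 0 * (fps_const c * qratio x r)" .
  moreover have "qexp x 0 \<noteq> 0"
    using qexp_nth_0[of x 0] by (metis fps_zero_nth zero_neq_one)
  ultimately have "A = fps_const c * qratio x r" by simp
  then have "A $ m = c * qratio x r $ m" by simp
  then show ?thesis by (simp add: A_def c_def qcount_def)
qed


section \<open>Forests and parent maps\<close>

text \<open>For \<open>p\<close> mapping \<open>V - R\<close> into \<open>V\<close>, the existence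
  of \<open>d\<close> encodes acyclicity: \<open>d\<close> drops by one along \<open>p\<close>, so
  iterating \<open>p\<close> must end in \<open>R\<close>.\<close>

definition is_depth :: "'v set \<Rightarrow> 'v set \<Rightarrow> ('v \<Rightarrow> 'v) \<Rightarrow> ('v \<Rightarrow> nat) \<Rightarrow> bool" where
  "is_depth V R p d \<longleftrightarrow> (\<forall>v\<in>R. d v = 0) \<and> (\<forall>v\<in>V - R. d v = Suc (d (p v)))"

text \<open>The extensional function space fixes \<open>p\<close> outside \<open>V - R\<close>, so
  that each forest has exactly one parent map.\<close>

definition parent_maps :: "'v set \<Rightarrow> 'v set \<Rightarrow> ('v \<Rightarrow> 'v) set" where
  "parent_maps V R = {p \<in> (V - R) \<rightarrow>\<^sub>E V. \<exists>d. is_depth V R p d}"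

definition parent_graph :: "'v set \<Rightarrow> 'v set \<Rightarrow> ('v \<Rightarrow> 'v) \<Rightarrow> 'v set set" where
  "parent_graph V R p = (\<lambda>v. {v, p v}) ` (V - R)"

lemma sym_adj: "(u, v) \<in> adj E \<Longrightarrow> (v, u) \<in> adj E"
  by (auto simp: adj_def insert_commute)

lemma sym_adj_rtrancl: "(u, v) \<in> (adj E)\<^sup>* \<Longrightarrow> (v, u) \<in> (adj E)\<^sup>*"
  by (meson sym_adj symD symI sym_rtrancl)

lemma gdist_le: "(u, v) \<in> adj E ^^ k \<Longrightarrow> gdist E u v \<le> k"
  unfolding gdist_def by (rule Least_le)

lemma gdist_relpow: "(u, v) \<in> (adj E)\<^sup>* \<Longrightarrow> (u, v) \<in> adj E ^^ gdist E u v"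
  unfolding gdist_def by (metis LeastI_ex rtrancl_imp_relpow)

section \<open>The graph of a parent map is a rooted forest with the expected depths and
  parents\<close>

locale parent_map =
  fixes V R :: "'v set" and p d
  assumes RV: "R \<subseteq> V" and p: "p \<in> (V - R) \<rightarrow>\<^sub>E V" and d: "is_depth V R p d"
begin

abbreviation "E \<equiv> parent_graph V R p"

lemma d_root: "v \<in> R \<Longrightarrow> d v = 0"
  using d by (simp add: is_depth_def)

lemma d_parent: "v \<in> V - R \<Longrightarrow> d v = Suc (d (p v))"
  using d by (simp add: is_depth_def)

lemma p_mem: "v \<in> V - R \<Longrightarrow> p v \<in> V"
  using p by auto

lemma d_eq_0_iff: "v \<in> V \<Longrightarrow> d v = 0 \<longleftrightarrow> v \<in> R"
  using d_root d_parent by (cases "v \<in> R") auto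

lemma adj_iff: "(u, v) \<in> adj E \<longleftrightarrow> (u \<in> V - R \<and> v = p u) \<or> (v \<in> V - R \<and> u = p v)"
  using d_parent by (fastforce simp: adj_def parent_graph_def doubleton_eq_iff)

lemma adj_verts: "(u, v) \<in> adj E \<Longrightarrow> u \<in> V \<and> v \<in> V"
  using p_mem by (auto simp: adj_iff)

text \<open>Every edge joins a vertex to its parent one level up, so depth tells which end is the
  child. Hence a vertex has at most one neighbour that is not deeper than itself.\<close>

lemma adj_parent: "(u, v) \<in> adj E \<Longrightarrow> d u \<le> d v \<Longrightarrow> v \<in> V - R \<and> u = p v"
  using d_parent by (fastforce simp: adj_iff)

lemma adj_depth: "(u, v) \<in> adj E \<Longrightarrow> d v \<le> Suc (d u)"
  using d_parent by (fastforce simp: adj_iff)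

text \<open>A vertex of maximal depth on a cycle would have its parent as both of its neighbours.\<close>

lemma no_cycle: "\<not> is_cycle E vs"
proof
  assume "is_cycle E vs"
  then have len: "length vs \<ge> 3" and dist: "distinct vs"
    and cyc: "\<And>i. i < length vs \<Longrightarrow> (vs ! i, vs ! (Suc i mod length vs)) \<in> adj E"
    by (auto simp: is_cycle_def)
  define l where "l = length vs"
  define m where "m = Max (d ` set vs)"
  have "m \<in> d ` set vs" unfolding m_def using len by (intro Max_in) auto
  then obtain j where j: "j < l" "d (vs ! j) = m" by (auto simp: in_set_conv_nth l_def)
  have max: "d (vs ! i) \<le> d (vs ! j)" if "i < l" for i
    using that j(2) by (simp add: m_def l_def)
  \<comment> \<open>\<open>a\<close> and \<open>b\<close> are the positions after and before
    \<open>j\<close> on the cycle; they differ because the length is at least 3.\<close>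
  define a where "a = Suc j mod l"
  define b where "b = (if j = 0 then l - 1 else j - 1)"
  have ab: "a < l" "b < l" "a \<noteq> b" "Suc b mod l = j"
    using j len by (auto simp: a_def b_def l_def mod_Suc split: if_splits)
  have "(vs ! a, vs ! j) \<in> adj E"
    using cyc[of j] j by (auto simp: a_def l_def intro: sym_adj)
  then have "vs ! a = p (vs ! j)" using max[OF ab(1)] adj_parent by blast
  moreover have "(vs ! b, vs ! j) \<in> adj E"
    using cyc[of b] ab by (auto simp: l_def)
  then have "vs ! b = p (vs ! j)" using max[OF ab(2)] adj_parent by blast
  ultimately have "vs ! a = vs ! b" by simp
  then show False
    using ab(1-3) dist nth_eq_iff_index_eq unfolding l_def by blast
qed

text \<open>For \<open>v\<close> in \<open>V\<close>, climbing \<open>d v\<close> times ends at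
  depth 0, hence in \<open>R\<close>. The result is constant along edges, which gives each component
  a single root.\<close>

definition root :: "'v \<Rightarrow> 'v" where
  "root v = (p ^^ d v) v"

lemma root_root: "v \<in> R \<Longrightarrow> root v = v"
  by (simp add: root_def d_root)

lemma root_parent: "v \<in> V - R \<Longrightarrow> root v = root (p v)"
  by (simp add: root_def d_parent funpow_swap1)

lemma root_adj: "(u, v) \<in> adj E \<Longrightarrow> root u = root v"
  by (auto simp: adj_iff root_parent)

lemma root_connected: "(u, v) \<in> (adj E)\<^sup>* \<Longrightarrow> root u = root v"
  by (induction rule: rtrancl_induct) (auto dest: root_adj)

lemma root_path: "v \<in> V \<Longrightarrow> root v \<in> R \<and> (root v, v) \<in> adj E ^^ d v"
proof (induction "d v" arbitrary: v)
  case 0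
  then have "v \<in> R" using d_eq_0_iff[of v] by simp
  then show ?case by (simp add: root_root d_root)
next
  case (Suc k)
  then have v: "v \<in> V - R" by (metis DiffI d_root nat.distinct(1))
  then have k: "d (p v) = k" using Suc(2) d_parent by auto
  have "root (p v) \<in> R \<and> (root (p v), p v) \<in> adj E ^^ k"
    using Suc(1)[of "p v"] k p_mem[OF v] by auto
  moreover have "(p v, v) \<in> adj E" using v by (simp add: adj_iff)
  ultimately show ?case using Suc(2)[symmetric] root_parent[OF v] by auto
qed

lemma root_rtrancl: "v \<in> V \<Longrightarrow> (root v, v) \<in> (adj E)\<^sup>*"
  using root_path relpow_imp_rtrancl by blast

lemma forest: "E \<in> rooted_forests V R"
proof -
  have "E \<subseteq> {e. e \<subseteq> V \<and> card e = 2}"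
  proof
    fix e assume "e \<in> E"
    then obtain v where v: "v \<in> V - R" "e = {v, p v}" by (auto simp: parent_graph_def)
    moreover have "v \<noteq> p v" using d_parent[OF v(1)] by auto
    ultimately show "e \<in> {e. e \<subseteq> V \<and> card e = 2}" using p_mem[OF v(1)] by auto
  qed
  moreover have "\<exists>!r. r \<in> T \<inter> R" if T: "T \<in> V // (adj E)\<^sup>*" for T
  proof -
    obtain v where v: "v \<in> V" "T = (adj E)\<^sup>* `` {v}" using T by (auto elim: quotientE)
    show ?thesis
    proof
      show "root v \<in> T \<inter> R"
        using v root_path[OF v(1)] sym_adj_rtrancl[OF root_rtrancl[OF v(1)]] by simp
      show "r = root v" if "r \<in> T \<inter> R" for r
        using that v root_connected[of v r] root_root by auto
    qed
  qed
  ultimately show ?thesis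
    using no_cycle by (auto simp: rooted_forests_def)
qed

lemma root_of_eq:
  assumes "v \<in> V"
  shows "root_of E R v = root v"
  unfolding root_of_def
proof (rule the_equality)
  show "root v \<in> R \<and> (v, root v) \<in> (adj E)\<^sup>*"
    using root_path[OF assms] sym_adj_rtrancl[OF root_rtrancl[OF assms]] by simp
  show "r = root v" if "r \<in> R \<and> (v, r) \<in> (adj E)\<^sup>*" for r
    using that root_connected[of v r] root_root[of r] by simp
qed

text \<open>Climbing from \<open>v\<close> gives a walk of length \<open>d v\<close>. No shorter one
  exists, since \<open>d\<close> is 0 at the root and grows by at most one per edge.\<close>

lemma depth_eq: assumes "v \<in> V" shows "depth E R v = d v"
proof -
  have lower: "d w \<le> d u + k" if "(u, w) \<in> adj E ^^ k" for u w k
    using that by (induction k arbitrary: w) (auto dest!: adj_depth intro: le_trans)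
  have "gdist E (root v) v \<le> d v"
    using root_path assms by (intro gdist_le) auto
  moreover have "d v \<le> gdist E (root v) v"
    using lower[OF gdist_relpow[OF root_rtrancl[OF assms]]] root_path[OF assms] d_root by simp
  ultimately show ?thesis by (simp add: depth_def root_of_eq assms)
qed

lemma parent_eq: assumes "v \<in> V - R" shows "parent E R v = p v"
  unfolding parent_def
proof (rule the_equality)
  show "(p v, v) \<in> adj E \<and> depth E R v = Suc (depth E R (p v))"
    using assms p_mem by (auto simp: adj_iff depth_eq d_parent)
  show "u = p v" if "(u, v) \<in> adj E \<and> depth E R v = Suc (depth E R u)" for u
    using that assms adj_verts[of u v] adj_parent[of u v] by (auto simp: depth_eq)
qed

end

text \<open>A shortest walk repeats no vertex, as cutting out the part between two equal vertices
  would shorten it.\<close>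

lemma distinct_path:
  assumes "(a, b) \<in> (adj E)\<^sup>*"
  obtains vs where "vs \<noteq> []" "distinct vs" "hd vs = a" "last vs = b"
    "\<forall>i. Suc i < length vs \<longrightarrow> (vs ! i, vs ! Suc i) \<in> adj E"
proof -
  define k where "k = gdist E a b"
  obtain f where f: "f 0 = a" "f k = b" "\<And>i. i < k \<Longrightarrow> (f i, f (Suc i)) \<in> adj E"
    using gdist_relpow[OF assms] unfolding k_def[symmetric] relpow_fun_conv by blast
  have "f i \<noteq> f j" if ij: "i < j" "j \<le> k" for i j
  proof
    assume eq: "f i = f j"
    have "(a, f i) \<in> adj E ^^ i"
      unfolding relpow_fun_conv using f ij by (intro exI[of _ f]) auto
    moreover have "(f j, b) \<in> adj E ^^ (k - j)"
      unfolding relpow_fun_conv using f ij by (intro exI[of _ "\<lambda>i. f (j + i)"]) auto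
    ultimately have "(a, b) \<in> adj E ^^ (i + (k - j))"
      using eq by (auto simp: relpow_add)
    then have "k \<le> i + (k - j)" unfolding k_def by (rule gdist_le)
    with ij show False by simp
  qed
  then have inj: "inj_on f {..k}" by (intro linorder_inj_onI) auto
  show ?thesis
  proof (rule that[of "map f [0..<Suc k]"])
    show "distinct (map f [0..<Suc k])"
      using inj by (simp add: distinct_map inj_on_def del: upt_Suc)
    show "hd (map f [0..<Suc k]) = a" using f by (simp add: hd_map del: upt_Suc)
    show "last (map f [0..<Suc k]) = b" using f by (simp add: last_map)
    show "\<forall>i. Suc i < length (map f [0..<Suc k]) \<longrightarrow>
        (map f [0..<Suc k] ! i, map f [0..<Suc k] ! Suc i) \<in> adj E"
      using f(3) by (simp del: upt_Suc)
  qed simp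
qed

text \<open>Choose for every non-root a neighbour one step closer to its root.  An edge missed by this
  choice would close a cycle with the chosen path between its ends.\<close>

lemma forest_parent_map:
  assumes RV: "R \<subseteq> V" and E: "E \<in> rooted_forests V R"
  obtains p where "p \<in> parent_maps V R" "E = parent_graph V R p"
proof -
  have edges: "e \<subseteq> V" "card e = 2" if "e \<in> E" for e
    using E that by (auto simp: rooted_forests_def)
  have acyc: "\<not> is_cycle E vs" for vs
    using E by (auto simp: rooted_forests_def)
  have adjV: "u \<in> V \<and> v \<in> V" if "(u, v) \<in> adj E" for u v
    using that edges by (auto simp: adj_def)
  have ex1: "\<exists>!r. r \<in> R \<and> (v, r) \<in> (adj E)\<^sup>*" if "v \<in> V" for v
  proof -
    have "(adj E)\<^sup>* `` {v} \<in> V // (adj E)\<^sup>*" using that by (rule quotientI)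
    then have "\<exists>!r. r \<in> (adj E)\<^sup>* `` {v} \<inter> R" using E by (auto simp: rooted_forests_def)
    then show ?thesis by (simp add: conj_commute)
  qed
  define r where "r = root_of E R"
  have r: "r v \<in> R" "(v, r v) \<in> (adj E)\<^sup>*" if "v \<in> V" for v
    using theI'[OF ex1[OF that]] by (auto simp: r_def root_of_def)
  have r_eq: "r v = s" if "v \<in> V" "s \<in> R" "(v, s) \<in> (adj E)\<^sup>*" for v s
    using ex1 r that by blast
  define d where "d = depth E R"
  have d_path: "(r v, v) \<in> adj E ^^ d v" if "v \<in> V" for v
    unfolding d_def depth_def r_def[symmetric]
    using r[OF that] by (intro gdist_relpow) (rule sym_adj_rtrancl)
  have d_le: "d v \<le> k" if "(r v, v) \<in> adj E ^^ k" for v k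
    using gdist_le[OF that] by (simp add: d_def depth_def r_def)
  have r_adj: "r u = r v" if "(u, v) \<in> adj E" for u v
    using r_eq[of u "r v"] r[of v] adjV[OF that] that by (meson converse_rtrancl_into_rtrancl)
  \<comment> \<open>\<open>u\<close> is the last vertex before \<open>v\<close> on a shortest walk
    from the root; were it nearer to the root than \<open>k\<close>, \<open>v\<close> would be
    nearer too.\<close>
  have "\<exists>u. (u, v) \<in> adj E \<and> d v = Suc (d u)" if v: "v \<in> V - R" for v
  proof (cases "d v")
    case 0
    then show ?thesis using d_path[of v] r(1)[of v] v by auto
  next
    case (Suc k)
    then obtain u where u: "(r v, u) \<in> adj E ^^ k" "(u, v) \<in> adj E"
      using d_path[of v] v by auto
    have uv: "r u = r v" by (rule r_adj[OF u(2)])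
    have "d u \<le> k" using u uv by (intro d_le) simp
    moreover have "d v \<le> Suc (d u)"
    proof (rule d_le)
      have "(r v, u) \<in> adj E ^^ d u" using d_path[of u] adjV[OF u(2)] uv by simp
      then show "(r v, v) \<in> adj E ^^ Suc (d u)" using u(2) by auto
    qed
    ultimately show ?thesis using Suc u by auto
  qed
  then obtain p0 where p0: "\<And>v. v \<in> V - R \<Longrightarrow> (p0 v, v) \<in> adj E \<and> d v = Suc (d (p0 v))"
    by metis
  define p where "p = restrict p0 (V - R)"
  have p: "(p v, v) \<in> adj E" "d v = Suc (d (p v))" if "v \<in> V - R" for v
    using p0[OF that] that by (auto simp: p_def)
  have d0: "d v = 0" if "v \<in> R" for v
  proof -
    have "r v = v" using that RV by (intro r_eq) auto
    then show ?thesis using d_le[of v 0] by simp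
  qed
  have pE: "p \<in> (V - R) \<rightarrow>\<^sub>E V"
    using p0 adjV by (fastforce simp: p_def)
  have dep: "is_depth V R p d"
    using d0 p by (auto simp: is_depth_def)
  interpret P: parent_map V R p d
    by unfold_locales (use RV pE dep in auto)
  have sub: "parent_graph V R p \<subseteq> E"
    using p(1) by (auto simp: parent_graph_def adj_def insert_commute)
  then have adj_sub: "adj (parent_graph V R p) \<subseteq> adj E"
    by (auto simp: adj_def)
  have "E \<subseteq> parent_graph V R p"
  proof
    fix e assume e: "e \<in> E"
    then obtain a b where ab: "e = {a, b}" "a \<noteq> b" "a \<in> V" "b \<in> V"
      using edges[OF e] by (auto simp: card_2_iff)
    show "e \<in> parent_graph V R p"
    proof (rule ccontr)
      assume ne: "e \<notin> parent_graph V R p"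
      have abE: "(a, b) \<in> adj E" using ab e by (auto simp: adj_def)
      \<comment> \<open>The parent graph is a subgraph of \<open>E\<close>, so both assign the same
        roots. Being adjacent in \<open>E\<close>, \<open>a\<close> and \<open>b\<close> share a
        root and are thus already connected in the parent graph.\<close>
      have "P.root v = r v" if "v \<in> V" for v
        using r_eq[OF that, of "P.root v"] P.root_path[OF that]
          sym_adj_rtrancl[OF subsetD[OF rtrancl_mono[OF adj_sub] P.root_rtrancl[OF that]]] by simp
      then have "P.root a = P.root b" using r_adj[OF abE] ab by simp
      then have "(a, b) \<in> (adj (parent_graph V R p))\<^sup>*"
        using rtrancl_trans[OF sym_adj_rtrancl[OF P.root_rtrancl[of a]]] P.root_rtrancl[of b] ab
        by simp
      then obtain vs where vs: "vs \<noteq> []" "distinct vs" "hd vs = a" "last vs = b"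
        "\<forall>i. Suc i < length vs \<longrightarrow> (vs ! i, vs ! Suc i) \<in> adj (parent_graph V R p)"
        by (rule distinct_path)
      define l where "l = length vs"
      have nth: "vs ! 0 = a" "vs ! (l - 1) = b" "l > 0"
        using vs by (auto simp: hd_conv_nth last_conv_nth l_def)
      \<comment> \<open>Length 1 would force \<open>a = b\<close>, and length 2 would put the missed
        edge into the parent graph.\<close>
      have "l \<noteq> 1" using nth ab by auto
      moreover have "l \<noteq> 2"
        using vs(5)[rule_format, of 0] nth ab ne by (auto simp: l_def adj_def)
      ultimately have "l \<ge> 3" using nth by simp
      moreover have "(vs ! i, vs ! (Suc i mod l)) \<in> adj E" if "i < l" for i
      proof (cases "Suc i = l")
        case True
        then show ?thesis using nth sym_adj[OF abE] by (metis diff_Suc_1 mod_self)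
      next
        case False
        then show ?thesis using vs(5)[rule_format, of i] that adj_sub by (auto simp: l_def)
      qed
      ultimately have "is_cycle E vs" using vs by (simp add: is_cycle_def l_def)
      with acyc show False by blast
    qed
  qed
  with sub have "E = parent_graph V R p" by blast
  moreover have "p \<in> parent_maps V R" using pE dep by (auto simp: parent_maps_def)
  ultimately show ?thesis using that by blast
qed

text \<open>Injectivity holds because \<open>parent\<close> recovers the map from the graph and
  \<open>R\<close> alone.\<close>

lemma bij_betw_parent_graph:
  assumes "R \<subseteq> V"
  shows "bij_betw (parent_graph V R) (parent_maps V R) (rooted_forests V R)"
  unfolding bij_betw_def
proof
  show "inj_on (parent_graph V R) (parent_maps V R)"
  proof (rule inj_onI)
    fix p p' assume p: "p \<in> parent_maps V R" and p': "p' \<in> parent_maps V R"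
      and eq: "parent_graph V R p = parent_graph V R p'"
    obtain d d' where "parent_map V R p d" "parent_map V R p' d'"
      using p p' assms by (auto simp: parent_maps_def parent_map_def)
    then have "p v = p' v" if "v \<in> V - R" for v
      using parent_map.parent_eq that eq by metis
    then show "p = p'" using p p' by (auto simp: parent_maps_def intro: PiE_ext)
  qed
  show "parent_graph V R ` parent_maps V R = rooted_forests V R"
  proof safe
    fix p assume "p \<in> parent_maps V R"
    then obtain d where "parent_map V R p d"
      using assms by (auto simp: parent_maps_def parent_map_def)
    then show "parent_graph V R p \<in> rooted_forests V R" by (rule parent_map.forest)
  next
    fix E assume "E \<in> rooted_forests V R"
    then show "E \<in> parent_graph V R ` parent_maps V R"
      using forest_parent_map[OF assms] by blast
  qed
qed


section \<open>The recursion for forests\<close>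

lemma finite_parent_maps: "finite V \<Longrightarrow> finite (parent_maps V R)"
  by (rule finite_subset[of _ "(V - R) \<rightarrow>\<^sub>E V"]) (auto simp: parent_maps_def intro: finite_PiE)

lemma parent_maps_D:
  assumes "R \<subseteq> V" "p \<in> parent_maps V R"
  obtains d where "parent_map V R p d"
  using assms by (auto simp: parent_maps_def parent_map_def)

text \<open>The parent of a vertex with least \<open>d\<close> would have a smaller value
  still.\<close>

lemma parent_maps_no_roots: "V \<noteq> {} \<Longrightarrow> parent_maps V {} = {}"
proof (rule equals0I)
  fix p assume "V \<noteq> {}" and p: "p \<in> parent_maps V {}"
  obtain d where "parent_map V {} p d" using parent_maps_D[OF empty_subsetI p] .
  then interpret parent_map V "{}" p d .
  have step: "p v \<in> V" "d v = Suc (d (p v))" if "v \<in> V" for v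
    using that p_mem d_parent by simp_all
  obtain v where v: "v \<in> V" "\<And>w. w \<in> V \<Longrightarrow> d v \<le> d w"
    using ex_has_least_nat[of "\<lambda>v. v \<in> V" _ d] \<open>V \<noteq> {}\<close> by blast
  show False using v(2)[OF step(1)[OF v(1)]] step(2)[OF v(1)] by simp
qed

context parent_map
begin

lemma level_eq: "level V E R i = {v \<in> V. d v = i}"
  by (auto simp: level_def depth_eq)

text \<open>Indexing by the depths that occur avoids comparing heights when roots are deleted; empty
  levels contribute 0. The form also holds for empty \<open>V\<close>, where \<open>height\<close>
  is the maximum of an empty set.\<close>

lemma level_stat_eq:
  assumes "finite V"
  shows "level_stat V \<rho> R E = (\<Sum>i\<in>d ` (V - R). card {v \<in> V. d v = i} choose 2) +
    (\<Sum>v\<in>V - R. \<rho> {w \<in> V. d w = d (p v)} (p v) - 1)"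
proof -
  have h: "height V E R = Max (d ` V)"
    unfolding height_def level_eq by (rule arg_cong[of _ _ Max]) auto
  have "(\<Sum>i=1..height V E R. card (level V E R i) choose 2)
      = (\<Sum>i\<in>d ` (V - R). card {v \<in> V. d v = i} choose 2)"
    unfolding level_eq h
  proof (rule sum.mono_neutral_right)
    show "d ` (V - R) \<subseteq> {1..Max (d ` V)}"
    proof
      fix i assume "i \<in> d ` (V - R)"
      then obtain v where v: "v \<in> V - R" "i = d v" by blast
      moreover have "d v \<le> Max (d ` V)" using v assms by (intro Max_ge) auto
      ultimately show "i \<in> {1..Max (d ` V)}" using d_parent[OF v(1)] by simp
    qed
    show "\<forall>i\<in>{1..Max (d ` V)} - d ` (V - R). card {v \<in> V. d v = i} choose 2 = 0"
    proof
      fix i assume i: "i \<in> {1..Max (d ` V)} - d ` (V - R)"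
      then have "d v \<noteq> i" if "v \<in> V" for v
        using that d_root[of v] by (cases "v \<in> R") auto
      then have "{v \<in> V. d v = i} = {}" by blast
      then show "card {v \<in> V. d v = i} choose 2 = 0"
        by (simp only: card.empty binomial_eq_0[OF zero_less_numeral])
    qed
  qed simp
  moreover have "weight V \<rho> E R (parent E R v) = \<rho> {w \<in> V. d w = d (p v)} (p v)"
    if "v \<in> V - R" for v
    using p_mem[OF that] by (simp add: weight_def parent_eq[OF that] level_eq depth_eq)
  ultimately show ?thesis by (simp add: level_stat_def)
qed

end

text \<open>
  Deleting the roots \<open>R\<close> of a forest leaves a forest whose roots are the set \<open>S\<close> of vertices of
  depth 1; the original forest is recovered from the map \<open>f\<close> of \<open>S\<close> to their parents in \<open>R\<close>.
\<close>

definition glue :: "'v set \<Rightarrow> ('v \<Rightarrow> 'v) \<Rightarrow> ('v \<Rightarrow> 'v) \<Rightarrow> 'v \<Rightarrow> 'v" where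
  "glue S f p = (\<lambda>v. if v \<in> S then f v else p v)"

lemma parent_map_glue:
  assumes RV: "R \<subseteq> V" and S: "S \<subseteq> V - R" and f: "f \<in> S \<rightarrow>\<^sub>E R"
    and p: "parent_map (V - R) S p d"
  shows "parent_map V R (glue S f p) (\<lambda>v. if v \<in> V - R then Suc (d v) else 0)"
proof -
  interpret P: parent_map "V - R" S p d by (rule p)
  have "glue S f p \<in> V - R \<rightarrow>\<^sub>E V"
  proof (rule PiE_I)
    show "glue S f p v \<in> V" if "v \<in> V - R" for v
      using that RV f P.p_mem[of v] by (cases "v \<in> S") (auto simp: glue_def)
    show "glue S f p v = undefined" if "v \<notin> V - R" for v
      using that S PiE_arb[OF P.p, of v] by (auto simp: glue_def)
  qed
  moreover have "is_depth V R (glue S f p) (\<lambda>v. if v \<in> V - R then Suc (d v) else 0)"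
    unfolding is_depth_def
  proof (intro conjI ballI)
    fix v assume v: "v \<in> V - R"
    show "(if v \<in> V - R then Suc (d v) else 0) =
        Suc (if glue S f p v \<in> V - R then Suc (d (glue S f p v)) else 0)"
    proof (cases "v \<in> S")
      case True
      then have "f v \<in> R" using f by auto
      with True v show ?thesis by (simp add: glue_def P.d_root)
    next
      case False
      with v have v': "v \<in> V - R - S" by simp
      show ?thesis
        using v False P.p_mem[OF v'] P.d_parent[OF v'] by (simp add: glue_def)
    qed
  qed auto
  ultimately show ?thesis using RV by (simp add: parent_map_def)
qed

text \<open>Level i of the smaller forest is, as a set, level i + 1 of the glued one, so the ranking
  assigns the same weights. New are only level 1, which is \<open>S\<close>, and the edges from
  \<open>S\<close> to \<open>R\<close>.\<close>

lemma level_stat_glue: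
  assumes fin: "finite V" and RV: "R \<subseteq> V" and S: "S \<subseteq> V - R" and f: "f \<in> S \<rightarrow>\<^sub>E R"
    and p: "p \<in> parent_maps (V - R) S"
  shows "level_stat V \<rho> R (parent_graph V R (glue S f p))
    = (card S choose 2) + (\<Sum>v\<in>S. \<rho> R (f v) - 1)
      + level_stat (V - R) \<rho> S (parent_graph (V - R) S p)"
proof -
  obtain d where d: "parent_map (V - R) S p d" using parent_maps_D[OF S p] .
  define d' where "d' = (\<lambda>v. if v \<in> V - R then Suc (d v) else 0)"
  interpret P: parent_map "V - R" S p d by (rule d)
  interpret Q: parent_map V R "glue S f p" d'
    unfolding d'_def by (rule parent_map_glue[OF RV S f d])
  have level: "{v \<in> V. d' v = Suc i} = {v \<in> V - R. d v = i}" for i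
    by (auto simp: d'_def)
  have level0: "{v \<in> V. d' v = 0} = R" "{v \<in> V - R. d v = 0} = S"
    using RV S P.d_eq_0_iff by (auto simp: d'_def)
  have "(\<Sum>i\<in>d' ` (V - R). card {v \<in> V. d' v = i} choose 2)
      = (\<Sum>i\<in>d ` (V - R). card {v \<in> V - R. d v = i} choose 2)"
  proof -
    have "d' ` (V - R) = Suc ` d ` (V - R)" by (auto simp: d'_def image_iff)
    then show ?thesis by (simp add: sum.reindex level)
  qed
  \<comment> \<open>Index 0 stands for \<open>S\<close>, which the statistic of the smaller forest
    does not count, its levels starting at 1. If \<open>S\<close> is empty the added term is
    0.\<close>
  also have "\<dots> = (\<Sum>i\<in>insert 0 (d ` (V - R - S)). card {v \<in> V - R. d v = i} choose 2)"
  proof (rule sum.mono_neutral_left)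
    show "d ` (V - R) \<subseteq> insert 0 (d ` (V - R - S))" using P.d_root by auto
    show "\<forall>i\<in>insert 0 (d ` (V - R - S)) - d ` (V - R). card {v \<in> V - R. d v = i} choose 2 = 0"
    proof
      fix i assume "i \<in> insert 0 (d ` (V - R - S)) - d ` (V - R)"
      then have "{v \<in> V - R. d v = i} = {}" by blast
      then show "card {v \<in> V - R. d v = i} choose 2 = 0"
        by (simp only: card.empty binomial_eq_0[OF zero_less_numeral])
    qed
  qed (use fin in simp)
  also have "\<dots> = (card S choose 2)
      + (\<Sum>i\<in>d ` (V - R - S). card {v \<in> V - R. d v = i} choose 2)"
  proof -
    have "0 \<notin> d ` (V - R - S)" using P.d_parent by auto
    then show ?thesis
      by (simp only: sum.insert finite_imageI finite_Diff fin level0 not_False_eq_True)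
  qed
  finally have lev: "(\<Sum>i\<in>d' ` (V - R). card {v \<in> V. d' v = i} choose 2) = \<dots>" .
  have "(\<Sum>v\<in>V - R. \<rho> {w \<in> V. d' w = d' (glue S f p v)} (glue S f p v) - 1)
      = (\<Sum>v\<in>V - R - S. \<rho> {w \<in> V. d' w = d' (glue S f p v)} (glue S f p v) - 1)
      + (\<Sum>v\<in>S. \<rho> {w \<in> V. d' w = d' (glue S f p v)} (glue S f p v) - 1)"
    using fin S by (intro sum.subset_diff) auto
  also have "(\<Sum>v\<in>S. \<rho> {w \<in> V. d' w = d' (glue S f p v)} (glue S f p v) - 1)
      = (\<Sum>v\<in>S. \<rho> R (f v) - 1)"
  proof (rule sum.cong[OF refl])
    fix v assume v: "v \<in> S"
    then have "f v \<in> R" using f by auto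
    then have "d' (f v) = 0" by (simp add: d'_def)
    then show "\<rho> {w \<in> V. d' w = d' (glue S f p v)} (glue S f p v) - 1 = \<rho> R (f v) - 1"
      using v by (simp add: glue_def level0)
  qed
  also have "(\<Sum>v\<in>V - R - S. \<rho> {w \<in> V. d' w = d' (glue S f p v)} (glue S f p v) - 1)
      = (\<Sum>v\<in>V - R - S. \<rho> {w \<in> V - R. d w = d (p v)} (p v) - 1)"
  proof (rule sum.cong[OF refl])
    fix v assume v: "v \<in> V - R - S"
    have "glue S f p v = p v" "d' (p v) = Suc (d (p v))"
      using v P.p_mem[OF v] by (simp_all add: glue_def d'_def)
    then show "\<rho> {w \<in> V. d' w = d' (glue S f p v)} (glue S f p v) - 1
        = \<rho> {w \<in> V - R. d w = d (p v)} (p v) - 1"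
      by (simp only: level)
  qed
  finally show ?thesis
    using lev fin by (simp only: Q.level_stat_eq[OF fin] P.level_stat_eq[OF finite_Diff[OF fin]])
qed

text \<open>Conversely to gluing, \<open>S\<close> is read off as the set of vertices whose parent
  lies in \<open>R\<close>, and \<open>f\<close> and the smaller parent map are
  restrictions.\<close>

lemma sum_parent_maps_split:
  fixes g :: "('v \<Rightarrow> 'v) \<Rightarrow> 'a::comm_monoid_add"
  assumes fin: "finite V" and RV: "R \<subseteq> V"
  shows "(\<Sum>p\<in>parent_maps V R. g p)
    = (\<Sum>S\<in>Pow (V - R). \<Sum>f\<in>S \<rightarrow>\<^sub>E R. \<Sum>p\<in>parent_maps (V - R) S. g (glue S f p))"
proof -
  let ?S = "\<lambda>p. {v \<in> V - R. p v \<in> R}"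
  have "(\<Sum>S\<in>Pow (V - R). \<Sum>f\<in>S \<rightarrow>\<^sub>E R. \<Sum>p\<in>parent_maps (V - R) S. g (glue S f p))
      = (\<Sum>S\<in>Pow (V - R). \<Sum>(f, p)\<in>(S \<rightarrow>\<^sub>E R) \<times> parent_maps (V - R) S. g (glue S f p))"
    by (simp add: sum.cartesian_product)
  also have "\<dots> = (\<Sum>(S, f, p)\<in>Sigma (Pow (V - R)) (\<lambda>S. (S \<rightarrow>\<^sub>E R) \<times> parent_maps (V - R) S).
      g (glue S f p))"
  proof (rule sum.Sigma)
    show "\<forall>S\<in>Pow (V - R). finite ((S \<rightarrow>\<^sub>E R) \<times> parent_maps (V - R) S)"
      using fin finite_subset[OF RV fin]
      by (auto intro!: finite_PiE finite_parent_maps dest: finite_subset[OF _ finite_Diff])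
  qed (use fin in simp)
  also have "\<dots> = (\<Sum>p\<in>parent_maps V R. g p)"
  proof (rule sum.reindex_bij_witness[of _
        "\<lambda>p. (?S p, restrict p (?S p), restrict p (V - R - ?S p))" "\<lambda>(S, f, p). glue S f p"])
    fix P assume "P \<in> Sigma (Pow (V - R)) (\<lambda>S. (S \<rightarrow>\<^sub>E R) \<times> parent_maps (V - R) S)"
    then obtain S f p where P: "P = (S, f, p)" "S \<subseteq> V - R" "f \<in> S \<rightarrow>\<^sub>E R"
      "p \<in> parent_maps (V - R) S" by auto
    obtain d where d: "parent_map (V - R) S p d" using parent_maps_D[OF P(2,4)] .
    then interpret Q: parent_map V R "glue S f p" "\<lambda>v. if v \<in> V - R then Suc (d v) else 0"
      using parent_map_glue[OF RV P(2,3)] by blast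
    interpret Q': parent_map "V - R" S p d by (rule d)
    show "(\<lambda>(S, f, p). glue S f p) P \<in> parent_maps V R"
      using Q.p Q.d by (auto simp: parent_maps_def P(1))
    have S: "?S (glue S f p) = S"
      using P(2,3) Q'.p_mem by (fastforce simp: glue_def)
    have "restrict (glue S f p) S = f"
      using P(3) by (auto simp: glue_def fun_eq_iff PiE_iff extensional_def)
    moreover have "restrict (glue S f p) (V - R - S) = p"
      using Q'.p by (auto simp: glue_def fun_eq_iff PiE_iff extensional_def)
    ultimately show "(\<lambda>p. (?S p, restrict p (?S p), restrict p (V - R - ?S p)))
        ((\<lambda>(S, f, p). glue S f p) P) = P"
      by (simp only: P(1) case_prod_conv S)
    show "g ((\<lambda>(S, f, p). glue S f p) P) = (\<lambda>(S, f, p). g (glue S f p)) P"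
      by (simp add: P(1))
  next
    fix p assume p: "p \<in> parent_maps V R"
    then obtain d where "parent_map V R p d" using parent_maps_D[OF RV] by blast
    then interpret Q: parent_map V R p d .
    define S where "S = ?S p"
    have "restrict p (V - R - S) \<in> V - R - S \<rightarrow>\<^sub>E V - R"
      using Q.p_mem by (auto simp: S_def)
    \<comment> \<open>Truncation does no harm: every vertex outside \<open>R\<close> has depth at
      least 1.\<close>
    moreover have "is_depth (V - R) S (restrict p (V - R - S)) (\<lambda>v. d v - 1)"
      using Q.p_mem Q.d_parent Q.d_root by (auto simp: is_depth_def S_def)
    ultimately have "restrict p (V - R - S) \<in> parent_maps (V - R) S"
      by (auto simp: parent_maps_def)
    then show "(?S p, restrict p (?S p), restrict p (V - R - ?S p))
        \<in> Sigma (Pow (V - R)) (\<lambda>S. (S \<rightarrow>\<^sub>E R) \<times> parent_maps (V - R) S)"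
      by (auto simp: S_def)
    show "(\<lambda>(S, f, p). glue S f p) (?S p, restrict p (?S p), restrict p (V - R - ?S p)) = p"
      using Q.p by (auto simp: glue_def fun_eq_iff PiE_iff extensional_def)
  qed
  finally show ?thesis ..
qed

text \<open>Here the choice of ranking drops out: its values on \<open>R\<close> are 1 to
  \<open>card R\<close>, each once, so the sum is geometric. The factor 1 - x avoids a division and
  admits x = 1.\<close>

lemma sum_ranking:
  fixes x :: "'a::comm_ring_1"
  assumes "is_ranking V \<rho>" "R \<subseteq> V"
  shows "(1 - x) * (\<Sum>u\<in>R. x ^ (\<rho> R u - 1)) = 1 - x ^ card R"
proof -
  have "bij_betw (\<rho> R) R {1..card R}" using assms by (simp add: is_ranking_def)
  then have "(\<Sum>u\<in>R. x ^ (\<rho> R u - 1)) = (\<Sum>i=1..card R. x ^ (i - 1))"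
    by (rule sum.reindex_bij_betw)
  also have "\<dots> = (\<Sum>i<card R. x ^ i)"
    by (rule sum.reindex_bij_witness[of _ Suc "\<lambda>i. i - 1"]) auto
  finally show ?thesis by (simp add: one_diff_power_eq)
qed

text \<open>Both sides satisfy the same recursion, by induction on the number of vertices.
  \<open>R\<close> may be empty or all of \<open>V\<close>, because the next root set ranges over
  all subsets of \<open>V - R\<close>.\<close>

lemma sum_forests:
  fixes x :: "'a::field_char_0"
  assumes "finite V" "R \<subseteq> V" "is_ranking V \<rho>"
  shows "(1 - x) ^ card (V - R) * (\<Sum>F\<in>rooted_forests V R. x ^ level_stat V \<rho> R F)
    = qcount x (card R) (card (V - R))"
proof -
  define G where "G V R = (\<Sum>p\<in>parent_maps V R. x ^ level_stat V \<rho> R (parent_graph V R p))"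
    for V R
  have "(1 - x) ^ card (V - R) * G V R = qcount x (card R) (card (V - R))"
    using assms
  proof (induction "card V" arbitrary: V R rule: less_induct)
    case less
    note fin = less.prems(1) and RV = less.prems(2) and rank = less.prems(3)
    show ?case
    proof (cases "R = {}")
      case True
      show ?thesis
      proof (cases "V = {}")
        case V: True
        have "parent_maps {} {} = {\<lambda>_. undefined :: 'b}"
          by (auto simp: parent_maps_def is_depth_def)
        moreover have "parent_map {} {} (\<lambda>_. undefined :: 'b) (\<lambda>_. 0)"
          by (auto simp: parent_map_def is_depth_def)
        ultimately show ?thesis
          using True V by (simp add: G_def qcount_0 parent_map.level_stat_eq)
      next
        case False
        then have "card V \<noteq> 0" using fin by simp
        then show ?thesis
          using True False by (simp add: G_def qcount_0 parent_maps_no_roots)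
      qed
    next
      case False
      define m where "m = card (V - R)"
      have fin': "finite (V - R)" using fin by simp
      have less_card: "card (V - R) < card V"
        using False fin RV by (intro psubset_card_mono) auto
      have rank': "is_ranking (V - R) \<rho>" using rank by (auto simp: is_ranking_def)
      have "G V R = (\<Sum>S\<in>Pow (V - R). \<Sum>f\<in>S \<rightarrow>\<^sub>E R. \<Sum>p\<in>parent_maps (V - R) S.
          x ^ (card S choose 2) * (\<Prod>v\<in>S. x ^ (\<rho> R (f v) - 1)) *
          x ^ level_stat (V - R) \<rho> S (parent_graph (V - R) S p))"
        unfolding G_def sum_parent_maps_split[OF fin RV]
        by (intro sum.cong refl)
           (simp add: level_stat_glue[OF fin RV] power_add power_sum)
      also have "\<dots> = (\<Sum>S\<in>Pow (V - R).
          x ^ (card S choose 2) * (\<Sum>u\<in>R. x ^ (\<rho> R u - 1)) ^ card S * G (V - R) S)"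
      proof (rule sum.cong[OF refl])
        fix S assume "S \<in> Pow (V - R)"
        then have finS: "finite S" using fin' finite_subset by blast
        \<comment> \<open>The vertices of \<open>S\<close> choose their parents in \<open>R\<close>
          independently.\<close>
        have "(\<Sum>f\<in>S \<rightarrow>\<^sub>E R. \<Prod>v\<in>S. x ^ (\<rho> R (f v) - 1)) = (\<Sum>u\<in>R. x ^ (\<rho> R u - 1)) ^ card S"
          using prod_sum_PiE[OF finS, of "\<lambda>_. R" "\<lambda>_ u. x ^ (\<rho> R u - 1)"]
            finite_subset[OF RV fin] by simp
        then show "(\<Sum>f\<in>S \<rightarrow>\<^sub>E R. \<Sum>p\<in>parent_maps (V - R) S.
            x ^ (card S choose 2) * (\<Prod>v\<in>S. x ^ (\<rho> R (f v) - 1)) *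
            x ^ level_stat (V - R) \<rho> S (parent_graph (V - R) S p))
          = x ^ (card S choose 2) * (\<Sum>u\<in>R. x ^ (\<rho> R u - 1)) ^ card S * G (V - R) S"
          unfolding G_def by (simp flip: sum_distrib_left sum_distrib_right)
      qed
      finally have "(1 - x) ^ m * G V R = (\<Sum>S\<in>Pow (V - R). (1 - x) ^ m *
          (x ^ (card S choose 2) * (\<Sum>u\<in>R. x ^ (\<rho> R u - 1)) ^ card S * G (V - R) S))"
        by (simp only: sum_distrib_left)
      also have "\<dots> = (\<Sum>S\<in>Pow (V - R).
          x ^ (card S choose 2) * (1 - x ^ card R) ^ card S * qcount x (card S) (m - card S))"
      proof (rule sum.cong[OF refl])
        fix S assume "S \<in> Pow (V - R)"
        then have S: "S \<subseteq> V - R" by simp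
        then have c: "card (V - R - S) = m - card S" "card S \<le> m"
          using fin' by (simp_all add: m_def card_Diff_subset finite_subset card_mono)
        have IH: "(1 - x) ^ (m - card S) * G (V - R) S = qcount x (card S) (m - card S)"
          using less.hyps[OF less_card fin' S rank'] c by simp
        \<comment> \<open>One factor 1 - x goes to the geometric sum of each vertex in
          \<open>S\<close>; the other m - \<open>card S\<close> are those of the induction
          hypothesis.\<close>
        have "(1 - x) ^ m = (1 - x) ^ card S * (1 - x) ^ (m - card S)"
          using c by (simp flip: power_add)
        then show "(1 - x) ^ m *
            (x ^ (card S choose 2) * (\<Sum>u\<in>R. x ^ (\<rho> R u - 1)) ^ card S * G (V - R) S)
          = x ^ (card S choose 2) * (1 - x ^ card R) ^ card S * qcount x (card S) (m - card S)"
          by (simp add: IH[symmetric] sum_ranking[OF rank RV, of x, symmetric] power_mult_distrib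
              mult_ac)
      qed
      also have "\<dots> = qcount x (card R) m"
        using sum_card_subsets[OF fin', of "\<lambda>j. x ^ (j choose 2) * (1 - x ^ card R) ^ j * qcount x j (m - j)"]
        by (simp only: qcount_rec[of x "card R" "card (V - R)"] m_def)
      finally show ?thesis by (simp only: m_def)
    qed
  qed
  moreover have "G V R = (\<Sum>F\<in>rooted_forests V R. x ^ level_stat V \<rho> R F)"
    unfolding G_def by (rule sum.reindex_bij_betw[OF bij_betw_parent_graph[OF assms(2)]])
  ultimately show ?thesis by simp
qed

theorem theorem9p4:
  fixes n r :: nat and R :: "nat set" and \<phi> :: "ratfun symfun \<Rightarrow> ratfun"
    and \<rho> :: "nat set \<Rightarrow> nat \<Rightarrow> nat"
  assumes "algebra_hom \<phi>"
    and "\<And>m. m \<ge> 1 \<Longrightarrow> \<phi> (elem_sym m) = q ^ (m choose 2) / fact m"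
    and "n \<ge> 1"
    and "R \<subset> {1..n}"
    and "card R = r"
    and "r \<ge> 1"
    and "is_ranking {1..n} \<rho>"
  shows "J_fun \<phi> n r = (\<Sum>F\<in>rooted_forests {1..n} R. q ^ level_stat {1..n} \<rho> R F)"
proof -
  have R: "R \<subseteq> {1..n}" using assms(4) by simp
  have r: "r \<le> n" using card_mono[OF _ R] assms(5) by simp
  have m: "card ({1..n} - R) = n - r"
    using card_Diff_subset[OF finite_subset[OF R] R] assms(5) by simp
  have "\<phi> (p_sym n r) = q ^ (r choose 2) / (fact r * fact (n - r)) * qcount q r (n - r)"
    using algebra_hom_p_sym[OF assms(1,2), of "n - r" r] r by simp
  also have "qcount q r (n - r)
      = (1 - q) ^ (n - r) * (\<Sum>F\<in>rooted_forests {1..n} R. q ^ level_stat {1..n} \<rho> R F)"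
    using sum_forests[OF _ R assms(7), of q] m assms(5) by simp
  finally show ?thesis
    by (intro J_fun_iff[THEN iffD1, symmetric]) (simp only: mult_ac)
qed

end
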